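(* For non-preemptive machine replenishment, the Whittle index policy is an arbitrarily poor approximation, even with $2$ machines and $M=1$ repair per step: for every $\epsilon>0$ there is such an instance in which the value of the Whittle index policy is at most $\epsilon$ times the value of an optimal policy.
   Context: Non-preemptive machine replenishment: $n$ machines; machine $i$ has a finite set $\mathcal S_i$ of active states with initial state $\rho_i$. While active, machine $i$ in state $u$ earns $r_u\ge0$ per step and moves to $v$ with probability $\mathbf p_{uv}$ per step, independently of other machines. At any step an active machine in state $u$ may be moved to the repair queue at cost $c_u$; it earns nothing while in the queue. At most $M$ machines are worked on per step; repairs are non-preemptive (once started, continued every step until completion); each step machine $i$ is worked on, its repair completes w.p. $s_i$, after which it returns to $\rho_i$. The value of a policy is the time-average expected reward minus repair cost. Whittle index: for machine $i$ alone, with a penalty $\lambda$ charged per time step of repair, consider the policy maximizing time-average reward minus cost minus penalty; the Whittle index of state $u$ of machine $i$ is the largest penalty $\lambda$ such that this optimal single-machine policy still sends the machine for repair on entering state $u$ (it may be negative). The Whittle index policy treats sending a machine for repair as "playing" it and plays (sends for repair) the machine whose current state has the highest Whittle index, where machines in states with negative index are not sent for repair. *)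

theory Defs
  imports "HOL-Probability.Probability"
begin

record 's machine =
  active_states :: "'s set"
  initial_state :: 's
  reward_of :: "'s \<Rightarrow> real"
  cost_of :: "'s \<Rightarrow> real"
  transition :: "'s \<Rightarrow> 's pmf"
  repair_rate :: real

definition valid_machine :: "'s machine \<Rightarrow> bool" where
  "valid_machine m \<longleftrightarrow>
     finite (active_states m) \<and>
     initial_state m \<in> active_states m \<and>
     (\<forall>u\<in>active_states m. 0 \<le> reward_of m u \<and> 0 \<le> cost_of m u \<and>
        set_pmf (transition m u) \<subseteq> active_states m) \<and>
     0 < repair_rate m \<and> repair_rate m \<le> 1"

text \<open>
  A machine in the repair queue is either waiting (\<open>Queued\<close>) or its repair has been
  started and is not complete (\<open>InRepair\<close>).
\<close>

datatype 's status = Active 's | Queued | InRepair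

text \<open>
  The machines of a system are indexed by a finite set \<open>I\<close>. Outside \<open>I\<close> a joint state is
  \<open>Queued\<close>, a dummy value that plays no role.
\<close>

type_synonym 's joint = "nat \<Rightarrow> 's status"

definition in_repair :: "nat set \<Rightarrow> 's joint \<Rightarrow> nat set" where
  "in_repair I x = {i \<in> I. x i = InRepair}"

definition is_active :: "'s status \<Rightarrow> bool" where
  "is_active z \<longleftrightarrow> (\<exists>u. z = Active u)"

text \<open>
  In each step, \<open>sent\<close> is the set of active machines moved to the repair queue and
  \<open>worked\<close> the set of machines worked on. A machine may be worked on in the very step in which
  it is sent.
\<close>

record action =
  sent :: "nat set"
  worked :: "nat set"

definition admissible :: "nat set \<Rightarrow> nat \<Rightarrow> 's joint \<Rightarrow> action \<Rightarrow> bool" where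
  "admissible I M x a \<longleftrightarrow>
     sent a \<subseteq> {i \<in> I. is_active (x i)} \<and>
     worked a \<subseteq> {i \<in> I. \<not> is_active (x i)} \<union> sent a \<and>
     in_repair I x \<subseteq> worked a \<and>
     card (worked a) \<le> M"

definition next_status :: "'s machine \<Rightarrow> bool \<Rightarrow> bool \<Rightarrow> 's status \<Rightarrow> 's status pmf" where
  "next_status m is_sent is_worked z =
     (if is_worked
      then map_pmf (\<lambda>done. if done then Active (initial_state m) else InRepair)
             (bernoulli_pmf (repair_rate m))
      else (case z of
              Active u \<Rightarrow> if is_sent then return_pmf Queued else map_pmf Active (transition m u)
            | _ \<Rightarrow> return_pmf z))"

definition joint_step ::
    "(nat \<Rightarrow> 's machine) \<Rightarrow> nat set \<Rightarrow> 's joint \<Rightarrow> action \<Rightarrow> 's joint pmf" where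
  "joint_step ms I x a =
     Pi_pmf I Queued (\<lambda>i. next_status (ms i) (i \<in> sent a) (i \<in> worked a) (x i))"

text \<open>
  A machine that is sent in the current step is in the queue, so it pays its cost and earns
  nothing. The number \<open>lam\<close> is the penalty per step of repair; it is \<open>0\<close> in the actual problem
  and is only used to define the Whittle index.
\<close>

definition step_reward ::
    "(nat \<Rightarrow> 's machine) \<Rightarrow> nat set \<Rightarrow> real \<Rightarrow> 's joint \<Rightarrow> action \<Rightarrow> real" where
  "step_reward ms I lam x a =
     (\<Sum>i\<in>I. (case x i of
               Active u \<Rightarrow> if i \<in> sent a then - cost_of (ms i) u else reward_of (ms i) u
             | _ \<Rightarrow> 0))
     - lam * real (card (worked a))"

text \<open>
  Histories are nonempty lists of joint states, the current state first. Past actions need not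
  be recorded, since policies are deterministic functions of the history.
\<close>

type_synonym 's policy = "'s joint list \<Rightarrow> action"

primrec run ::
    "(nat \<Rightarrow> 's machine) \<Rightarrow> nat set \<Rightarrow> 's policy \<Rightarrow> 's joint \<Rightarrow> nat \<Rightarrow> 's joint list pmf" where
  "run ms I \<pi> x0 0 = return_pmf [x0]"
| "run ms I \<pi> x0 (Suc t) =
     bind_pmf (run ms I \<pi> x0 t)
       (\<lambda>h. map_pmf (\<lambda>x. x # h) (joint_step ms I (hd h) (\<pi> h)))"

definition feasible ::
    "(nat \<Rightarrow> 's machine) \<Rightarrow> nat set \<Rightarrow> nat \<Rightarrow> 's joint \<Rightarrow> 's policy \<Rightarrow> bool" where
  "feasible ms I M x0 \<pi> \<longleftrightarrow>
     (\<forall>t. \<forall>h\<in>set_pmf (run ms I \<pi> x0 t). admissible I M (hd h) (\<pi> h))"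

text \<open>
  The lower limit is needed because the averages of a history-dependent policy need not
  converge.
\<close>

definition avg_value ::
    "(nat \<Rightarrow> 's machine) \<Rightarrow> nat set \<Rightarrow> real \<Rightarrow> 's joint \<Rightarrow> 's policy \<Rightarrow> ereal" where
  "avg_value ms I lam x0 \<pi> =
     liminf (\<lambda>T. ereal ((\<Sum>t<T. measure_pmf.expectation (run ms I \<pi> x0 t)
                                (\<lambda>h. step_reward ms I lam (hd h) (\<pi> h))) / real T))"

definition initial_joint :: "(nat \<Rightarrow> 's machine) \<Rightarrow> nat set \<Rightarrow> 's joint" where
  "initial_joint ms I = (\<lambda>i. if i \<in> I then Active (initial_state (ms i)) else Queued)"

definition policy_value :: "(nat \<Rightarrow> 's machine) \<Rightarrow> nat set \<Rightarrow> 's policy \<Rightarrow> ereal" where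
  "policy_value ms I \<pi> = avg_value ms I 0 (initial_joint ms I) \<pi>"

definition optimal_policy :: "(nat \<Rightarrow> 's machine) \<Rightarrow> nat set \<Rightarrow> nat \<Rightarrow> 's policy \<Rightarrow> bool" where
  "optimal_policy ms I M \<pi> \<longleftrightarrow>
     feasible ms I M (initial_joint ms I) \<pi> \<and>
     (\<forall>\<pi>'. feasible ms I M (initial_joint ms I) \<pi>' \<longrightarrow>
        policy_value ms I \<pi>' \<le> policy_value ms I \<pi>)"

text \<open>
  The problem for machine \<open>i\<close> alone is the system with index set \<open>{i}\<close> and capacity 1. There the
  only decision is whether to send the machine for repair: once sent, it is worked on at once.
  (If it could be parked in the queue for ever, then sending it would not entail repairing it,
  nor paying the penalty.)
\<close>

definition alone :: "nat \<Rightarrow> 's status \<Rightarrow> 's joint" where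
  "alone i z = (\<lambda>_. Queued)(i := z)"

definition single_feasible ::
    "(nat \<Rightarrow> 's machine) \<Rightarrow> nat \<Rightarrow> 's \<Rightarrow> 's policy \<Rightarrow> bool" where
  "single_feasible ms i u \<pi> \<longleftrightarrow>
     feasible ms {i} 1 (alone i (Active u)) \<pi> \<and>
     (\<forall>t. \<forall>h\<in>set_pmf (run ms {i} \<pi> (alone i (Active u)) t). sent (\<pi> h) \<subseteq> worked (\<pi> h))"

definition stationary :: "('s joint \<Rightarrow> action) \<Rightarrow> 's policy" where
  "stationary d = (\<lambda>h. d (hd h))"

text \<open>
  Optimality is required from every active state, so that the decision in a state \<open>u\<close> is
  constrained even if \<open>u\<close> is not visited from the initial state.
\<close>

definition single_optimal ::
    "(nat \<Rightarrow> 's machine) \<Rightarrow> nat \<Rightarrow> real \<Rightarrow> ('s joint \<Rightarrow> action) \<Rightarrow> bool" where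
  "single_optimal ms i lam d \<longleftrightarrow>
     (\<forall>u\<in>active_states (ms i).
        single_feasible ms i u (stationary d) \<and>
        (\<forall>\<pi>. single_feasible ms i u \<pi> \<longrightarrow>
           avg_value ms {i} lam (alone i (Active u)) \<pi>
             \<le> avg_value ms {i} lam (alone i (Active u)) (stationary d)))"

text \<open>
  At the critical penalty, sending and not sending are both optimal; hence the existential
  quantifier over optimal policies.
\<close>

definition repair_penalties :: "(nat \<Rightarrow> 's machine) \<Rightarrow> nat \<Rightarrow> 's \<Rightarrow> real set" where
  "repair_penalties ms i u =
     {lam. \<exists>d. single_optimal ms i lam d \<and> i \<in> sent (d (alone i (Active u)))}"

definition is_whittle_index :: "(nat \<Rightarrow> 's machine) \<Rightarrow> nat \<Rightarrow> 's \<Rightarrow> real \<Rightarrow> bool" where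
  "is_whittle_index ms i u w \<longleftrightarrow>
     w \<in> repair_penalties ms i u \<and> (\<forall>lam\<in>repair_penalties ms i u. lam \<le> w)"

text \<open>
  With indices \<open>W\<close>, the free repair capacity is filled with active machines of highest
  nonnegative index, ties being broken arbitrarily.
\<close>

definition candidates :: "nat set \<Rightarrow> (nat \<Rightarrow> 's \<Rightarrow> real) \<Rightarrow> 's joint \<Rightarrow> nat set" where
  "candidates I W x = {i \<in> I. \<exists>u. x i = Active u \<and> 0 \<le> W i u}"

definition current_index :: "(nat \<Rightarrow> 's \<Rightarrow> real) \<Rightarrow> 's joint \<Rightarrow> nat \<Rightarrow> real" where
  "current_index W x i = (case x i of Active u \<Rightarrow> W i u | _ \<Rightarrow> 0)"

definition whittle_action ::
    "nat set \<Rightarrow> nat \<Rightarrow> (nat \<Rightarrow> 's \<Rightarrow> real) \<Rightarrow> 's joint \<Rightarrow> action \<Rightarrow> bool" where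
  "whittle_action I M W x a \<longleftrightarrow>
     admissible I M x a \<and>
     worked a = in_repair I x \<union> sent a \<and>
     sent a \<subseteq> candidates I W x \<and>
     (\<forall>j\<in>candidates I W x - sent a.
        card (worked a) = M \<and>
        (\<forall>i\<in>sent a. current_index W x j \<le> current_index W x i))"

definition whittle_policy :: "(nat \<Rightarrow> 's machine) \<Rightarrow> nat set \<Rightarrow> nat \<Rightarrow> 's policy \<Rightarrow> bool" where
  "whittle_policy ms I M \<pi> \<longleftrightarrow>
     (\<exists>W. (\<forall>i\<in>I. \<forall>u\<in>active_states (ms i). is_whittle_index ms i u (W i u)) \<and>
          (\<forall>t. \<forall>h\<in>set_pmf (run ms I \<pi> (initial_joint ms I) t).
             whittle_action I M W (hd h) (\<pi> h)))"

end

theory Submission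
  imports Defs
begin

text \<open>
  The producer earns 1 in its initial state, then breaks and earns nothing until it is repaired,
  which takes one step; sending it whenever it is broken yields 1/2 per step, and no policy does
  better. The decoy never earns anything, its repair is free and takes \<open>1 / s\<close> steps on average.
  The indices are -1 and 1 for the fresh and the broken producer and 0 for the decoy. So whenever the
  producer is fresh, the Whittle index policy sends the decoy; as the repair is non-preemptive, the
  producer, broken one step later, has to wait for its completion. This earns 1 in about \<open>1 / s\<close> steps.

  All values are bounded by potential functions: if along every history the reward plus
  the expected increase of a bounded function of the state is at most (at least) \<open>g\<close>, then so is the
  time average.
\<close>

section \<open>Potential functions\<close>

lemma next_status_simps:
  "next_status m a True z =
     map_pmf (\<lambda>done. if done then Active (initial_state m) else InRepair) (bernoulli_pmf (repair_rate m))"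
  "next_status m False False (Active u) = map_pmf Active (transition m u)"
  "next_status m True False (Active u) = return_pmf Queued"
  "next_status m a False Queued = return_pmf Queued"
  "next_status m a False InRepair = return_pmf InRepair"
  by (simp_all add: next_status_def)

lemma finite_set_next_status:
  assumes "\<And>u. finite (set_pmf (transition m u))"
  shows "finite (set_pmf (next_status m a b z))"
  using assms by (auto simp: next_status_def split: status.splits)

lemma finite_set_joint_step:
  assumes "finite I" "\<And>i u. i \<in> I \<Longrightarrow> finite (set_pmf (transition (ms i) u))"
  shows "finite (set_pmf (joint_step ms I x a))"
  using assms unfolding joint_step_def
  by (auto simp: set_Pi_pmf intro!: finite_PiE_dflt finite_set_next_status)

text \<open>Supports stay finite along a run, so every real function of the history is integrable
  and expectations can be added and compared freely.\<close>

lemma finite_set_run: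
  assumes "finite I" "\<And>i u. i \<in> I \<Longrightarrow> finite (set_pmf (transition (ms i) u))"
  shows "finite (set_pmf (run ms I \<pi> x0 t))"
  by (induction t) (auto intro!: finite_set_joint_step assms)

lemma set_joint_step:
  "finite I \<Longrightarrow> x' \<in> set_pmf (joint_step ms I x a) \<longleftrightarrow>
     (\<forall>i. if i \<in> I then x' i \<in> set_pmf (next_status (ms i) (i \<in> sent a) (i \<in> worked a) (x i))
          else x' i = Queued)"
  by (simp add: joint_step_def set_Pi_pmf PiE_dflt_def if_bool_eq_conj)

text \<open>The marginals of a \<open>Pi_pmf\<close> are its factors. Hence a potential that reads
  one machine, or a sum of such potentials, needs only the law of single \<open>next_status\<close>
  steps.\<close>

lemma expectation_joint_step:
  assumes "finite I" "i \<in> I"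
  shows "measure_pmf.expectation (joint_step ms I x a) (\<lambda>x'. f (x' i)) =
         measure_pmf.expectation (next_status (ms i) (i \<in> sent a) (i \<in> worked a) (x i)) (f :: _ \<Rightarrow> real)"
proof -
  have "next_status (ms i) (i \<in> sent a) (i \<in> worked a) (x i) =
        map_pmf (\<lambda>x'. x' i) (joint_step ms I x a)"
    using assms by (simp add: joint_step_def Pi_pmf_component)
  then show ?thesis
    by simp
qed

text \<open>Preservation is asked per reachable history and not per state, because the same state
  may be followed by different actions depending on the past.\<close>

lemma run_invariant:
  assumes "P x0"
    and "\<And>t h x'. h \<in> set_pmf (run ms I \<pi> x0 t) \<Longrightarrow> P (hd h) \<Longrightarrow>
           x' \<in> set_pmf (joint_step ms I (hd h) (\<pi> h)) \<Longrightarrow> P x'"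
    and "h \<in> set_pmf (run ms I \<pi> x0 t)"
  shows "P (hd h)"
  using assms(3)
proof (induction t arbitrary: h)
  case 0
  then show ?case using assms(1) by simp
next
  case (Suc t)
  then obtain h' x' where h': "h' \<in> set_pmf (run ms I \<pi> x0 t)"
    and x': "x' \<in> set_pmf (joint_step ms I (hd h') (\<pi> h'))" and h: "h = x' # h'"
    by auto
  have "P x'"
    using h' Suc.IH[OF h'] x' by (rule assms(2))
  then show ?case
    by (simp add: h)
qed

text \<open>Telescoping: the expected one-step increments of \<open>\<phi>\<close> add up to its
  expectation at time \<open>T\<close> minus its initial value. A bound on each corrected summand
  thus bounds the total reward up to boundary terms.\<close>

lemma sum_expected_reward:
  fixes \<phi> :: "'s joint \<Rightarrow> real" and \<pi> :: "'s policy" and x0 :: "'s joint"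
  assumes "finite I" "\<And>i u. i \<in> I \<Longrightarrow> finite (set_pmf (transition (ms i) u))"
  defines "R \<equiv> run ms I \<pi> x0"
  shows "(\<Sum>t<T. measure_pmf.expectation (R t) (\<lambda>h. step_reward ms I lam (hd h) (\<pi> h))) =
         (\<Sum>t<T. measure_pmf.expectation (R t) (\<lambda>h. step_reward ms I lam (hd h) (\<pi> h)
              + measure_pmf.expectation (joint_step ms I (hd h) (\<pi> h)) \<phi> - \<phi> (hd h)))
         + \<phi> x0 - measure_pmf.expectation (R T) (\<lambda>h. \<phi> (hd h))"
proof (induction T)
  case 0
  then show ?case by (simp add: R_def)
next
  case (Suc T)
  have fin: "finite (set_pmf (R T))"
    unfolding R_def by (intro finite_set_run assms)
  \<comment> \<open>Law of total expectation, conditioning on the history up to time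
    \<open>T\<close>.\<close>
  have "measure_pmf.expectation (R (Suc T)) (\<lambda>h. \<phi> (hd h)) =
      measure_pmf.expectation (R T)
        (\<lambda>h. measure_pmf.expectation (joint_step ms I (hd h) (\<pi> h)) \<phi>)"
    unfolding R_def run.simps
    by (subst pmf_expectation_bind[OF fin[unfolded R_def]])
       (auto intro!: finite_set_joint_step assms simp: integral_measure_pmf[OF fin[unfolded R_def]])
  with Suc show ?case
    by (simp add: integrable_measure_pmf_finite[OF fin])
qed

text \<open>The boundary terms left by telescoping are at most \<open>2 * B\<close>, so they vanish
  in the average. The step condition is restricted to histories in the support, which is where
  feasibility of \<open>\<pi>\<close> can be used.\<close>

lemma avg_value_le:
  fixes \<phi> :: "'s joint \<Rightarrow> real"
  assumes fin: "finite I" "\<And>i u. i \<in> I \<Longrightarrow> finite (set_pmf (transition (ms i) u))"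
    and bd: "bounded (range \<phi>)"
    and step: "\<And>t h. h \<in> set_pmf (run ms I \<pi> x0 t) \<Longrightarrow>
       step_reward ms I lam (hd h) (\<pi> h) + measure_pmf.expectation (joint_step ms I (hd h) (\<pi> h)) \<phi>
         \<le> g + \<phi> (hd h)"
  shows "avg_value ms I lam x0 \<pi> \<le> ereal g"
proof -
  define R where "R = run ms I \<pi> x0"
  obtain B where B: "\<And>x. \<bar>\<phi> x\<bar> \<le> B"
    using bd by (auto simp: bounded_iff)
  have finR: "finite (set_pmf (R t))" for t
    unfolding R_def by (intro finite_set_run fin)
  note int = integrable_measure_pmf_finite[OF finR]
  have "(\<Sum>t<T. measure_pmf.expectation (R t) (\<lambda>h. step_reward ms I lam (hd h) (\<pi> h))) / real T
      \<le> g + 2 * B / real T" if "T > 0" for T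
  proof -
    have "measure_pmf.expectation (R t) (\<lambda>h. step_reward ms I lam (hd h) (\<pi> h)
        + measure_pmf.expectation (joint_step ms I (hd h) (\<pi> h)) \<phi> - \<phi> (hd h)) \<le> g" for t
      using step by (intro measure_pmf.integral_le_const int)
        (auto simp: AE_measure_pmf_iff R_def algebra_simps)
    then have "(\<Sum>t<T. measure_pmf.expectation (R t) (\<lambda>h. step_reward ms I lam (hd h) (\<pi> h)
        + measure_pmf.expectation (joint_step ms I (hd h) (\<pi> h)) \<phi> - \<phi> (hd h))) \<le> real T * g"
      using sum_mono[of "{..<T}" _ "\<lambda>_. g"] by simp
    moreover have "- B \<le> measure_pmf.expectation (R T) (\<lambda>h. \<phi> (hd h))"
      using B by (intro measure_pmf.integral_ge_const int) (auto simp: abs_le_iff minus_le_iff)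
    moreover have "\<phi> x0 \<le> B"
      using B[of x0] by simp
    moreover have "(\<Sum>t<T. measure_pmf.expectation (R t) (\<lambda>h. step_reward ms I lam (hd h) (\<pi> h))) =
        (\<Sum>t<T. measure_pmf.expectation (R t) (\<lambda>h. step_reward ms I lam (hd h) (\<pi> h)
            + measure_pmf.expectation (joint_step ms I (hd h) (\<pi> h)) \<phi> - \<phi> (hd h)))
        + \<phi> x0 - measure_pmf.expectation (R T) (\<lambda>h. \<phi> (hd h))"
      unfolding R_def by (rule sum_expected_reward[OF fin])
    ultimately have "(\<Sum>t<T. measure_pmf.expectation (R t) (\<lambda>h. step_reward ms I lam (hd h) (\<pi> h)))
        \<le> real T * g + 2 * B"
      by linarith
    then show ?thesis
      using that by (simp add: field_simps)
  qed
  \<comment> \<open>At \<open>T = 0\<close> the average is 0 by convention and may exceed a negative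
    \<open>g\<close>; the bound therefore starts at \<open>T = 1\<close>, which leaves the lower
    limit unaffected.\<close>
  then have "avg_value ms I lam x0 \<pi> \<le> liminf (\<lambda>T. ereal (g + 2 * B / real T))"
    unfolding avg_value_def R_def
    by (intro Liminf_mono) (auto intro!: eventually_sequentiallyI[of 1])
  also have "(\<lambda>T. g + 2 * B / real T) \<longlonglongrightarrow> g + 0"
    by (intro tendsto_intros lim_const_over_n)
  then have "liminf (\<lambda>T. ereal (g + 2 * B / real T)) = ereal g"
    by (intro lim_imp_Liminf) auto
  finally show ?thesis .
qed

text \<open>The telescoping argument with reversed inequalities. Negating rewards in
  \<open>avg_value_le\<close> would not do, since it turns the lower limit into an upper
  one.\<close>

lemma avg_value_ge:
  fixes \<phi> :: "'s joint \<Rightarrow> real"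
  assumes fin: "finite I" "\<And>i u. i \<in> I \<Longrightarrow> finite (set_pmf (transition (ms i) u))"
    and bd: "bounded (range \<phi>)"
    and step: "\<And>t h. h \<in> set_pmf (run ms I \<pi> x0 t) \<Longrightarrow>
       g + \<phi> (hd h)
         \<le> step_reward ms I lam (hd h) (\<pi> h) + measure_pmf.expectation (joint_step ms I (hd h) (\<pi> h)) \<phi>"
  shows "ereal g \<le> avg_value ms I lam x0 \<pi>"
proof -
  define R where "R = run ms I \<pi> x0"
  obtain B where B: "\<And>x. \<bar>\<phi> x\<bar> \<le> B"
    using bd by (auto simp: bounded_iff)
  have finR: "finite (set_pmf (R t))" for t
    unfolding R_def by (intro finite_set_run fin)
  note int = integrable_measure_pmf_finite[OF finR]
  have *: "g - 2 * B / real T \<le>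
      (\<Sum>t<T. measure_pmf.expectation (R t) (\<lambda>h. step_reward ms I lam (hd h) (\<pi> h))) / real T"
    if "T > 0" for T
  proof -
    have "g \<le> measure_pmf.expectation (R t) (\<lambda>h. step_reward ms I lam (hd h) (\<pi> h)
        + measure_pmf.expectation (joint_step ms I (hd h) (\<pi> h)) \<phi> - \<phi> (hd h))" for t
      using step by (intro measure_pmf.integral_ge_const int)
        (auto simp: AE_measure_pmf_iff R_def algebra_simps)
    then have "real T * g \<le> (\<Sum>t<T. measure_pmf.expectation (R t) (\<lambda>h. step_reward ms I lam (hd h) (\<pi> h)
        + measure_pmf.expectation (joint_step ms I (hd h) (\<pi> h)) \<phi> - \<phi> (hd h)))"
      using sum_mono[of "{..<T}" "\<lambda>_. g"] by simp
    moreover have "measure_pmf.expectation (R T) (\<lambda>h. \<phi> (hd h)) \<le> B"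
      using B by (intro measure_pmf.integral_le_const int) (auto simp: abs_le_iff)
    moreover have "- B \<le> \<phi> x0"
      using B[of x0] by simp
    moreover have "(\<Sum>t<T. measure_pmf.expectation (R t) (\<lambda>h. step_reward ms I lam (hd h) (\<pi> h))) =
        (\<Sum>t<T. measure_pmf.expectation (R t) (\<lambda>h. step_reward ms I lam (hd h) (\<pi> h)
            + measure_pmf.expectation (joint_step ms I (hd h) (\<pi> h)) \<phi> - \<phi> (hd h)))
        + \<phi> x0 - measure_pmf.expectation (R T) (\<lambda>h. \<phi> (hd h))"
      unfolding R_def by (rule sum_expected_reward[OF fin])
    ultimately have "real T * g - 2 * B \<le>
        (\<Sum>t<T. measure_pmf.expectation (R t) (\<lambda>h. step_reward ms I lam (hd h) (\<pi> h)))"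
      by linarith
    then show ?thesis
      using that by (auto dest: divide_right_mono[of _ _ "real T"] simp: diff_divide_distrib)
  qed
  have "(\<lambda>T. g - 2 * B / real T) \<longlonglongrightarrow> g - 0"
    by (intro tendsto_intros lim_const_over_n)
  then have "ereal g = liminf (\<lambda>T. ereal (g - 2 * B / real T))"
    by (intro lim_imp_Liminf[symmetric]) auto
  also have "\<dots> \<le> avg_value ms I lam x0 \<pi>"
    unfolding avg_value_def using *
    by (intro Liminf_mono) (auto intro!: eventually_sequentiallyI[of 1] simp: R_def)
  finally show ?thesis .
qed

section \<open>A single machine\<close>

text \<open>A sent machine is worked on at once, so it is never parked; an active machine can be
  worked on only if it is sent; a running repair cannot be interrupted. Three cases remain.\<close>

lemma single_action_cases:
  assumes "admissible {i} 1 (alone i z) a" "sent a \<subseteq> worked a" "z \<noteq> Queued"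
  obtains (wait) u where "z = Active u" "sent a = {}" "worked a = {}"
    | (send) u where "z = Active u" "sent a = {i}" "worked a = {i}"
    | (repair) "z = InRepair" "sent a = {}" "worked a = {i}"
  using assms
  by (cases z; cases "i \<in> sent a"; cases "i \<in> worked a")
     (auto simp: admissible_def is_active_def in_repair_def alone_def)

lemma single_feasibleD:
  assumes "single_feasible ms i u \<pi>" "h \<in> set_pmf (run ms {i} \<pi> (alone i (Active u)) t)"
  shows "admissible {i} 1 (hd h) (\<pi> h)" "sent (\<pi> h) \<subseteq> worked (\<pi> h)"
  using assms by (auto simp: single_feasible_def feasible_def simp del: One_nat_def)

text \<open>
  The set \<open>S\<close> of reachable active states depends on the policy: a policy that repairs in the initial
  state never leaves it.
\<close>

lemma single_run_state:
  assumes feas: "single_feasible ms i u0 \<pi>"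
    and S: "u0 \<in> S" "initial_state (ms i) \<in> S"
    and closed: "\<And>h u. u \<in> S \<Longrightarrow> hd h = alone i (Active u) \<Longrightarrow> i \<notin> sent (\<pi> h) \<Longrightarrow>
      set_pmf (transition (ms i) u) \<subseteq> S"
    and h: "h \<in> set_pmf (run ms {i} \<pi> (alone i (Active u0)) t)"
  shows "\<exists>z \<in> insert InRepair (Active ` S). hd h = alone i z"
  using _ _ h
proof (rule run_invariant)
  show "\<exists>z \<in> insert InRepair (Active ` S). alone i (Active u0) = alone i z"
    using S by auto
next
  fix t h x'
  assume h: "h \<in> set_pmf (run ms {i} \<pi> (alone i (Active u0)) t)"
    and "\<exists>z \<in> insert InRepair (Active ` S). hd h = alone i z"
    and x': "x' \<in> set_pmf (joint_step ms {i} (hd h) (\<pi> h))"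
  then obtain z where z: "z \<in> insert InRepair (Active ` S)" "hd h = alone i z"
    by blast
  have act: "admissible {i} 1 (alone i z) (\<pi> h)" "sent (\<pi> h) \<subseteq> worked (\<pi> h)" "z \<noteq> Queued"
    using single_feasibleD[OF feas h] z by auto
  \<comment> \<open>All other indices carry the dummy \<open>Queued\<close>, so component
    \<open>i\<close> determines the joint state.\<close>
  have x'_eq: "x' = alone i (x' i)"
    and x'_i: "x' i \<in> set_pmf (next_status (ms i) (i \<in> sent (\<pi> h)) (i \<in> worked (\<pi> h)) z)"
    using x' z(2) by (auto simp: set_joint_step alone_def fun_eq_iff split: if_splits)
  from act have "x' i \<in> insert InRepair (Active ` S)"
  proof (cases rule: single_action_cases)
    case (wait u)
    then have "u \<in> S"
      using z by auto
    then show ?thesis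
      using closed[of u h] x'_i wait z by (auto simp: next_status_simps)
  qed (use x'_i S in \<open>auto simp: next_status_simps split: if_splits\<close>)
  with x'_eq show "\<exists>z \<in> insert InRepair (Active ` S). x' = alone i z"
    by blast
qed

lemma single_step_reward:
  "step_reward ms {i} lam (alone i z) a =
     (case z of Active u \<Rightarrow> if i \<in> sent a then - cost_of (ms i) u else reward_of (ms i) u | _ \<Rightarrow> 0)
     - lam * real (card (worked a))"
  by (simp add: step_reward_def alone_def split: status.splits)

lemma expectation_single_step:
  "measure_pmf.expectation (joint_step ms {i} (alone i z) a) (\<lambda>x'. f (x' i)) =
   measure_pmf.expectation (next_status (ms i) (i \<in> sent a) (i \<in> worked a) z) (f :: _ \<Rightarrow> real)"
  by (subst expectation_joint_step) (auto simp: alone_def)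

lemma bounded_range_comp: "bounded (range f) \<Longrightarrow> bounded (range (\<lambda>x. f (g x)))"
  by (rule bounded_subset) auto

text \<open>The expected potential after one step of work. It is the same whether the repair starts
  or continues, and whatever state the machine was sent from.\<close>

definition repaired :: "'s machine \<Rightarrow> ('s status \<Rightarrow> real) \<Rightarrow> real" where
  "repaired m \<phi> = repair_rate m * \<phi> (Active (initial_state m)) + (1 - repair_rate m) * \<phi> InRepair"

lemma expectation_next_status_worked:
  assumes "valid_machine m"
  shows "measure_pmf.expectation (next_status m a True z) \<phi> = repaired m \<phi>"
  using assms by (simp add: next_status_simps valid_machine_def repaired_def)

text \<open>The potential inequality, split by the three possible actions. The premises on active
  states mention the decision taken, so for a particular policy only its actual decisions need
  checking. The condition at \<open>InRepair\<close> must hold even if the policy never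
  repairs.\<close>

lemma single_avg_value_le:
  assumes valid: "valid_machine (ms i)" and fin: "\<And>u. finite (set_pmf (transition (ms i) u))"
    and bd: "bounded (range \<phi>)"
    and feas: "single_feasible ms i u0 \<pi>"
    and S: "u0 \<in> S" "initial_state (ms i) \<in> S"
    and wait: "\<And>h u. u \<in> S \<Longrightarrow> hd h = alone i (Active u) \<Longrightarrow> i \<notin> sent (\<pi> h) \<Longrightarrow>
      set_pmf (transition (ms i) u) \<subseteq> S \<and>
      reward_of (ms i) u + measure_pmf.expectation (transition (ms i) u) (\<lambda>v. \<phi> (Active v))
        \<le> g + \<phi> (Active u)"
    and send: "\<And>h u. u \<in> S \<Longrightarrow> hd h = alone i (Active u) \<Longrightarrow> i \<in> sent (\<pi> h) \<Longrightarrow>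
      - cost_of (ms i) u - lam + repaired (ms i) \<phi> \<le> g + \<phi> (Active u)"
    and repair: "- lam + repaired (ms i) \<phi> \<le> g + \<phi> InRepair"
  shows "avg_value ms {i} lam (alone i (Active u0)) \<pi> \<le> ereal g"
proof (rule avg_value_le)
  show "bounded (range (\<lambda>x. \<phi> (x i)))"
    using bd by (rule bounded_range_comp)
next
  fix t h
  assume h: "h \<in> set_pmf (run ms {i} \<pi> (alone i (Active u0)) t)"
  obtain z where z: "z \<in> insert InRepair (Active ` S)" "hd h = alone i z"
    using single_run_state[OF feas S _ h] wait by blast
  have act: "admissible {i} 1 (alone i z) (\<pi> h)" "sent (\<pi> h) \<subseteq> worked (\<pi> h)" "z \<noteq> Queued"
    using single_feasibleD[OF feas h] z by auto
  have "step_reward ms {i} lam (alone i z) (\<pi> h)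
      + measure_pmf.expectation (joint_step ms {i} (alone i z) (\<pi> h)) (\<lambda>x. \<phi> (x i)) \<le> g + \<phi> z"
    using act
  proof (cases rule: single_action_cases)
    case (wait u)
    then show ?thesis
      using assms(7)[of u h] z by (auto simp: single_step_reward expectation_single_step next_status_simps)
  next
    case (send u)
    then show ?thesis
      using assms(8)[of u h] z by (auto simp: single_step_reward expectation_single_step
          expectation_next_status_worked[OF valid])
  next
    case repair
    then show ?thesis
      using assms(9) by (auto simp: single_step_reward expectation_single_step
          expectation_next_status_worked[OF valid])
  qed
  then show "step_reward ms {i} lam (hd h) (\<pi> h)
      + measure_pmf.expectation (joint_step ms {i} (hd h) (\<pi> h)) (\<lambda>x. \<phi> (x i)) \<le> g + \<phi> (hd h i)"
    using z by (simp add: alone_def)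
qed (use fin in auto)

lemma single_avg_value_ge:
  assumes valid: "valid_machine (ms i)" and fin: "\<And>u. finite (set_pmf (transition (ms i) u))"
    and bd: "bounded (range \<phi>)"
    and feas: "single_feasible ms i u0 \<pi>"
    and S: "u0 \<in> S" "initial_state (ms i) \<in> S"
    and wait: "\<And>h u. u \<in> S \<Longrightarrow> hd h = alone i (Active u) \<Longrightarrow> i \<notin> sent (\<pi> h) \<Longrightarrow>
      set_pmf (transition (ms i) u) \<subseteq> S \<and>
      g + \<phi> (Active u) \<le>
      reward_of (ms i) u + measure_pmf.expectation (transition (ms i) u) (\<lambda>v. \<phi> (Active v))"
    and send: "\<And>h u. u \<in> S \<Longrightarrow> hd h = alone i (Active u) \<Longrightarrow> i \<in> sent (\<pi> h) \<Longrightarrow>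
      g + \<phi> (Active u) \<le> - cost_of (ms i) u - lam + repaired (ms i) \<phi>"
    and repair: "g + \<phi> InRepair \<le> - lam + repaired (ms i) \<phi>"
  shows "ereal g \<le> avg_value ms {i} lam (alone i (Active u0)) \<pi>"
proof (rule avg_value_ge)
  show "bounded (range (\<lambda>x. \<phi> (x i)))"
    using bd by (rule bounded_range_comp)
next
  fix t h
  assume h: "h \<in> set_pmf (run ms {i} \<pi> (alone i (Active u0)) t)"
  obtain z where z: "z \<in> insert InRepair (Active ` S)" "hd h = alone i z"
    using single_run_state[OF feas S _ h] wait by blast
  have act: "admissible {i} 1 (alone i z) (\<pi> h)" "sent (\<pi> h) \<subseteq> worked (\<pi> h)" "z \<noteq> Queued"
    using single_feasibleD[OF feas h] z by auto
  have "g + \<phi> z \<le> step_reward ms {i} lam (alone i z) (\<pi> h)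
      + measure_pmf.expectation (joint_step ms {i} (alone i z) (\<pi> h)) (\<lambda>x. \<phi> (x i))"
    using act
  proof (cases rule: single_action_cases)
    case (wait u)
    then show ?thesis
      using assms(7)[of u h] z by (auto simp: single_step_reward expectation_single_step next_status_simps)
  next
    case (send u)
    then show ?thesis
      using assms(8)[of u h] z by (auto simp: single_step_reward expectation_single_step
          expectation_next_status_worked[OF valid])
  next
    case repair
    then show ?thesis
      using assms(9) by (auto simp: single_step_reward expectation_single_step
          expectation_next_status_worked[OF valid])
  qed
  then show "g + \<phi> (hd h i) \<le> step_reward ms {i} lam (hd h) (\<pi> h)
      + measure_pmf.expectation (joint_step ms {i} (hd h) (\<pi> h)) (\<lambda>x. \<phi> (x i))"
    using z by (simp add: alone_def)
qed (use fin in auto)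

section \<open>Stationary sending policies and a criterion for Whittle indices\<close>

definition send_at :: "nat \<Rightarrow> 's set \<Rightarrow> 's joint \<Rightarrow> action" where
  "send_at i D x =
     \<lparr>sent = (if x i \<in> Active ` D then {i} else {}),
      worked = (if x i \<in> insert InRepair (Active ` D) then {i} else {})\<rparr>"

lemma single_feasible_send_at: "single_feasible ms i u (stationary (send_at i D))"
  by (auto simp: single_feasible_def feasible_def admissible_def stationary_def send_at_def
      is_active_def in_repair_def)

lemma sent_send_at:
  "hd h = alone i (Active u) \<Longrightarrow> i \<in> sent (stationary (send_at i D) h) \<longleftrightarrow> u \<in> D"
  by (auto simp: stationary_def send_at_def alone_def)

lemma is_whittle_index_unique:
  "is_whittle_index ms i u w \<Longrightarrow> is_whittle_index ms i u w' \<Longrightarrow> w = w'"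
  unfolding is_whittle_index_def by (meson order_antisym)

text \<open>The first two premises certify that \<open>send_at i D\<close> is optimal at penalty
  \<open>w\<close>, with the same gain \<open>g\<close> from every state; as it sends in
  \<open>u\<close>, the penalty \<open>w\<close> qualifies. No larger penalty does, because every
  stationary policy sending in \<open>u\<close> is then strictly beaten.\<close>

lemma is_whittle_indexI:
  assumes "\<And>u0 \<pi>. u0 \<in> active_states (ms i) \<Longrightarrow> single_feasible ms i u0 \<pi> \<Longrightarrow>
      avg_value ms {i} w (alone i (Active u0)) \<pi> \<le> ereal g"
    and "\<And>u0. u0 \<in> active_states (ms i) \<Longrightarrow>
      ereal g \<le> avg_value ms {i} w (alone i (Active u0)) (stationary (send_at i D))"
    and "u \<in> D" "u \<in> active_states (ms i)"
    and "\<And>lam d. lam > w \<Longrightarrow> single_feasible ms i u (stationary d) \<Longrightarrow>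
      i \<in> sent (d (alone i (Active u))) \<Longrightarrow>
      \<exists>\<pi>. single_feasible ms i u \<pi> \<and>
      avg_value ms {i} lam (alone i (Active u)) (stationary d) < avg_value ms {i} lam (alone i (Active u)) \<pi>"
  shows "is_whittle_index ms i u w"
proof -
  have "single_optimal ms i w (send_at i D)"
    unfolding single_optimal_def
    by (intro ballI conjI allI impI single_feasible_send_at order_trans[OF assms(1) assms(2)])
  then have "w \<in> repair_penalties ms i u"
    using assms(3) sent_send_at[of "[alone i (Active u)]" i u D]
    by (auto simp: repair_penalties_def stationary_def)
  moreover have "lam \<le> w" if "lam \<in> repair_penalties ms i u" for lam
  proof (rule ccontr)
    assume "\<not> lam \<le> w"
    then have "lam > w"
      by simp
    from that obtain d where d: "single_optimal ms i lam d" "i \<in> sent (d (alone i (Active u)))"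
      by (auto simp: repair_penalties_def)
    have "single_feasible ms i u (stationary d)"
      using d(1) assms(4) by (simp add: single_optimal_def)
    then obtain \<pi> where "single_feasible ms i u \<pi>"
      "avg_value ms {i} lam (alone i (Active u)) (stationary d) < avg_value ms {i} lam (alone i (Active u)) \<pi>"
      using assms(5)[of lam d] \<open>lam > w\<close> d(2) by blast
    then show False
      using d(1) assms(4) unfolding single_optimal_def by (meson not_le)
  qed
  ultimately show ?thesis
    by (simp add: is_whittle_index_def)
qed

section \<open>The instance\<close>

text \<open>State 0 is the fresh producer and state 1 the broken one, which is absorbing until the
  machine is sent.\<close>

definition producer :: "nat machine" where
  "producer = \<lparr>active_states = {0, 1}, initial_state = 0,
     reward_of = (\<lambda>u. if u = 0 then 1 else 0), cost_of = (\<lambda>_. 0),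
     transition = (\<lambda>_. return_pmf 1), repair_rate = 1\<rparr>"

definition decoy :: "real \<Rightarrow> nat machine" where
  "decoy s = \<lparr>active_states = {0}, initial_state = 0, reward_of = (\<lambda>_. 0), cost_of = (\<lambda>_. 0),
     transition = (\<lambda>_. return_pmf 0), repair_rate = s\<rparr>"

definition duo :: "real \<Rightarrow> nat \<Rightarrow> nat machine" where
  "duo s i = (if i = 0 then producer else decoy s)"

lemma duo_simps [simp]: "duo s 0 = producer" "duo s (Suc 0) = decoy s"
  by (simp_all add: duo_def)

lemma lessThan_2: "{..<2} = {0, Suc 0}"
  by auto

lemma producer_simps [simp]:
  "active_states producer = {0, 1}" "initial_state producer = 0"
  "reward_of producer u = (if u = 0 then 1 else 0)" "cost_of producer u = 0"
  "transition producer u = return_pmf 1" "repair_rate producer = 1"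
  by (simp_all add: producer_def)

lemma decoy_simps [simp]:
  "active_states (decoy s) = {0}" "initial_state (decoy s) = 0" "reward_of (decoy s) u = 0"
  "cost_of (decoy s) u = 0" "transition (decoy s) u = return_pmf 0" "repair_rate (decoy s) = s"
  by (simp_all add: decoy_def)

lemma valid_producer: "valid_machine producer"
  by (simp add: valid_machine_def)

lemma valid_decoy: "0 < s \<Longrightarrow> s \<le> 1 \<Longrightarrow> valid_machine (decoy s)"
  by (simp add: valid_machine_def)

lemma finite_transition_duo: "finite (set_pmf (transition (duo s i) u))"
  by (simp add: duo_def)

section \<open>Whittle indices of the producer and the decoy\<close>

lemma bounded_range_if: "bounded (range (\<lambda>z. if P z then a else (b :: real)))"
  by (rule finite_imp_bounded, rule finite_subset[of _ "{a, b}"]) auto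

text \<open>Repairing in state 1 gives a cycle of two steps, one earning 1 and one paying
  \<open>lam\<close>, hence the gain \<open>(1 - lam) / 2\<close>. Staying broken gives 0. The two
  agree at \<open>lam = 1\<close>.\<close>

lemma whittle_index_producer_broken: "is_whittle_index (duo s) 0 1 1"
proof (rule is_whittle_indexI[where D = "{1}" and g = 0])
  fix u0 \<pi>
  assume "u0 \<in> active_states (duo s 0)" "single_feasible (duo s) 0 u0 \<pi>"
  then show "avg_value (duo s) {0} 1 (alone 0 (Active u0)) \<pi> \<le> ereal 0"
    by (intro single_avg_value_le[where S = "{0, 1}" and \<phi> = "\<lambda>z. if z = Active 0 then 1 else 0", OF _ _ bounded_range_if])
       (auto simp: valid_producer finite_transition_duo repaired_def)
next
  fix u0
  assume "u0 \<in> active_states (duo s 0)"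
  then show "ereal 0 \<le> avg_value (duo s) {0} 1 (alone 0 (Active u0)) (stationary (send_at 0 {1}))"
    by (intro single_avg_value_ge[where S = "{0, 1}" and \<phi> = "\<lambda>z. if z = Active 0 then 1 else 0", OF _ _ bounded_range_if])
       (auto simp: valid_producer finite_transition_duo repaired_def
          single_feasible_send_at sent_send_at)
next
  fix lam :: real and d
  assume lam: "1 < lam"
    and d: "single_feasible (duo s) 0 1 (stationary d)" "0 \<in> sent (d (alone 0 (Active 1)))"
  \<comment> \<open>Waiting in state 1 would violate the inequality, as the claimed gain is
    negative; that case is void because \<open>d\<close> sends there.\<close>
  have "avg_value (duo s) {0} lam (alone 0 (Active 1)) (stationary d) \<le> ereal ((1 - lam) / 2)"
    using lam d
    by (intro single_avg_value_le[where S = "{0, 1}"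
          and \<phi> = "\<lambda>z. if z = Active 0 then (1 + lam) / 2 else 0", OF _ _ bounded_range_if])
       (auto simp: valid_producer finite_transition_duo repaired_def
          stationary_def field_simps)
  also have "\<dots> < ereal 0"
    using lam by simp
  \<comment> \<open>This policy never repairs; the value \<open>- lam\<close> at
    \<open>InRepair\<close> only serves the repair premise, paying for the single step of
    repair.\<close>
  also have "ereal 0 \<le> avg_value (duo s) {0} lam (alone 0 (Active 1)) (stationary (send_at 0 {}))"
    using lam
    by (intro single_avg_value_ge[where S = "{0, 1}" and \<phi> = "\<lambda>z. if z = InRepair then - lam else 0", OF _ _ bounded_range_if])
       (auto simp: valid_producer finite_transition_duo repaired_def
          single_feasible_send_at sent_send_at)
  finally show "\<exists>\<pi>. single_feasible (duo s) 0 1 \<pi> \<and>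
      avg_value (duo s) {0} lam (alone 0 (Active 1)) (stationary d)
        < avg_value (duo s) {0} lam (alone 0 (Active 1)) \<pi>"
    by (intro exI conjI) (rule single_feasible_send_at)
qed auto

text \<open>Since a repair takes exactly one step, a stationary policy that sends in state 0 is back
  there after each step and gains \<open>- lam\<close>. Repairing only when broken gains
  \<open>(1 - lam) / 2\<close>, which is larger exactly when \<open>lam > - 1\<close>.\<close>

lemma whittle_index_producer_fresh: "is_whittle_index (duo s) 0 0 (- 1)"
proof (rule is_whittle_indexI[where D = "{0, 1}" and g = 1])
  fix u0 \<pi>
  assume "u0 \<in> active_states (duo s 0)" "single_feasible (duo s) 0 u0 \<pi>"
  then show "avg_value (duo s) {0} (- 1) (alone 0 (Active u0)) \<pi> \<le> ereal 1"
    by (intro single_avg_value_le[where S = "{0, 1}" and \<phi> = "\<lambda>_. 0"])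
       (auto simp: valid_producer finite_transition_duo repaired_def)
next
  fix u0
  assume "u0 \<in> active_states (duo s 0)"
  then show "ereal 1 \<le> avg_value (duo s) {0} (- 1) (alone 0 (Active u0)) (stationary (send_at 0 {0, 1}))"
    by (intro single_avg_value_ge[where S = "{0, 1}" and \<phi> = "\<lambda>_. 0"])
       (auto simp: valid_producer finite_transition_duo repaired_def
          single_feasible_send_at sent_send_at)
next
  fix lam :: real and d
  assume lam: "- 1 < lam"
    and d: "single_feasible (duo s) 0 0 (stationary d)" "0 \<in> sent (d (alone 0 (Active 0)))"
  have "avg_value (duo s) {0} lam (alone 0 (Active 0)) (stationary d) \<le> ereal (- lam)"
    using lam d
    by (intro single_avg_value_le[where S = "{0}" and \<phi> = "\<lambda>_. 0"])
       (auto simp: valid_producer finite_transition_duo repaired_def stationary_def)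
  also have "\<dots> < ereal ((1 - lam) / 2)"
    using lam by simp
  also have "\<dots> \<le> avg_value (duo s) {0} lam (alone 0 (Active 0)) (stationary (send_at 0 {1}))"
    using lam
    by (intro single_avg_value_ge[where S = "{0, 1}"
          and \<phi> = "\<lambda>z. if z = Active 0 then (1 + lam) / 2 else 0", OF _ _ bounded_range_if])
       (auto simp: valid_producer finite_transition_duo repaired_def
          single_feasible_send_at sent_send_at field_simps)
  finally show "\<exists>\<pi>. single_feasible (duo s) 0 0 \<pi> \<and>
      avg_value (duo s) {0} lam (alone 0 (Active 0)) (stationary d)
        < avg_value (duo s) {0} lam (alone 0 (Active 0)) \<pi>"
    by (intro exI conjI) (rule single_feasible_send_at)
qed auto

text \<open>A stationary policy that sends the decoy pays \<open>lam\<close> in every step, and one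
  that never sends it earns 0. The index is therefore 0 for every \<open>s\<close>, which suffices
  to be a candidate for repair.\<close>

lemma whittle_index_decoy:
  assumes s: "0 < s" "s \<le> 1"
  shows "is_whittle_index (duo s) 1 0 0"
proof (rule is_whittle_indexI[where D = "{0}" and g = 0])
  fix u0 \<pi>
  assume "u0 \<in> active_states (duo s 1)" "single_feasible (duo s) 1 u0 \<pi>"
  then show "avg_value (duo s) {1} 0 (alone 1 (Active u0)) \<pi> \<le> ereal 0"
    by (intro single_avg_value_le[where S = "{0}" and \<phi> = "\<lambda>_. 0"])
       (auto simp: valid_decoy s finite_transition_duo repaired_def)
next
  fix u0
  assume "u0 \<in> active_states (duo s 1)"
  then show "ereal 0 \<le> avg_value (duo s) {1} 0 (alone 1 (Active u0)) (stationary (send_at 1 {0}))"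
    by (intro single_avg_value_ge[where S = "{0}" and \<phi> = "\<lambda>_. 0"])
       (auto simp: valid_decoy s finite_transition_duo repaired_def single_feasible_send_at)
next
  fix lam :: real and d
  assume lam: "0 < lam"
    and d: "single_feasible (duo s) 1 0 (stationary d)" "1 \<in> sent (d (alone 1 (Active 0)))"
  have "avg_value (duo s) {1} lam (alone 1 (Active 0)) (stationary d) \<le> ereal (- lam)"
    using lam d
    by (intro single_avg_value_le[where S = "{0}" and \<phi> = "\<lambda>_. 0"])
       (auto simp: valid_decoy s finite_transition_duo repaired_def stationary_def)
  also have "\<dots> < ereal 0"
    using lam by simp
  \<comment> \<open>The value \<open>- lam / s\<close> is minus the expected penalty of a repair,
    which lasts \<open>1 / s\<close> steps on average; again \<open>InRepair\<close> is not
    reached.\<close>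
  also have "ereal 0 \<le> avg_value (duo s) {1} lam (alone 1 (Active 0)) (stationary (send_at 1 {}))"
    using lam s
    by (intro single_avg_value_ge[where S = "{0}" and \<phi> = "\<lambda>z. if z = InRepair then - lam / s else 0", OF _ _ bounded_range_if])
       (auto simp: valid_decoy finite_transition_duo repaired_def
          single_feasible_send_at sent_send_at field_simps)
  finally show "\<exists>\<pi>. single_feasible (duo s) 1 0 \<pi> \<and>
      avg_value (duo s) {1} lam (alone 1 (Active 0)) (stationary d)
        < avg_value (duo s) {1} lam (alone 1 (Active 0)) \<pi>"
    by (intro exI conjI) (rule single_feasible_send_at)
qed auto

section \<open>The optimal value of the two-machine system\<close>

lemma step_reward_duo:
  "step_reward (duo s) {..<2} 0 x a = (if x 0 = Active 0 \<and> 0 \<notin> sent a then 1 else 0)"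
  by (simp add: step_reward_def lessThan_2 split: status.splits)

lemma initial_joint_duo:
  "initial_joint (duo s) {..<2} 0 = Active 0"
  "initial_joint (duo s) {..<2} (Suc 0) = Active 0"
  by (simp_all add: initial_joint_def)

lemma bernoulli_pmf_1 [simp]: "bernoulli_pmf 1 = return_pmf True"
proof (rule pmf_eqI)
  show "pmf (bernoulli_pmf 1) b = pmf (return_pmf True) b" for b
    by (cases b) simp_all
qed

lemma set_joint_step_duo:
  assumes "x' \<in> set_pmf (joint_step (duo s) {..<2} x a)"
  shows "x' 0 \<in> set_pmf (next_status producer (0 \<in> sent a) (0 \<in> worked a) (x 0))"
    and "x' (Suc 0) \<in> set_pmf (next_status (decoy s) (Suc 0 \<in> sent a) (Suc 0 \<in> worked a) (x (Suc 0)))"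
  using assms[unfolded set_joint_step[OF finite_lessThan], THEN spec, of 0]
    assms[unfolded set_joint_step[OF finite_lessThan], THEN spec, of "Suc 0"]
  by simp_all

text \<open>After an earning step the producer is broken, so it cannot earn in two successive steps.
  In the potential, being fresh is worth 1/2 more than any other status.\<close>

lemma policy_value_duo_le:
  assumes "feasible (duo s) {..<2} 1 (initial_joint (duo s) {..<2}) \<pi>"
  shows "policy_value (duo s) {..<2} \<pi> \<le> ereal (1 / 2)"
  unfolding policy_value_def
proof (rule avg_value_le)
  let ?\<phi> = "\<lambda>z. if z = Active 0 then 1 else 1 / 2 :: real"
  show "bounded (range (\<lambda>x. ?\<phi> (x 0)))"
    by (rule bounded_range_if)
  fix t h
  assume "h \<in> set_pmf (run (duo s) {..<2} \<pi> (initial_joint (duo s) {..<2}) t)"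
  then have adm: "admissible {..<2} 1 (hd h) (\<pi> h)"
    using assms by (auto simp: feasible_def)
  have *: "measure_pmf.expectation (joint_step (duo s) {..<2} (hd h) (\<pi> h)) (\<lambda>x. ?\<phi> (x 0)) =
      measure_pmf.expectation (next_status producer (0 \<in> sent (\<pi> h)) (0 \<in> worked (\<pi> h)) (hd h 0)) ?\<phi>"
    by (subst expectation_joint_step) auto
  show "step_reward (duo s) {..<2} 0 (hd h) (\<pi> h)
      + measure_pmf.expectation (joint_step (duo s) {..<2} (hd h) (\<pi> h)) (\<lambda>x. ?\<phi> (x 0))
      \<le> 1 / 2 + ?\<phi> (hd h 0)"
    unfolding * step_reward_duo using adm
    \<comment> \<open>Admissibility excludes working on an active producer that is not sent, which
      would earn 1 and keep it fresh.\<close>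
    by (cases "0 \<in> worked (\<pi> h)"; cases "hd h 0"; cases "0 \<in> sent (\<pi> h)")
       (auto simp: next_status_simps admissible_def is_active_def)
qed (auto simp: finite_transition_duo)

abbreviation tend_producer :: "nat policy" where
  "tend_producer \<equiv> stationary (send_at 0 {1})"

text \<open>The decoy is never sent and the producer's repair ends within its step, so no machine is
  ever in repair. This makes \<open>send_at\<close> admissible here: a decoy in repair would have to
  be worked on.\<close>

lemma run_tend_producer:
  assumes "h \<in> set_pmf (run (duo s) {..<2} tend_producer (initial_joint (duo s) {..<2}) t)"
  shows "hd h 0 \<in> {Active 0, Active 1} \<and> hd h (Suc 0) = Active 0"
  using _ _ assms
proof (rule run_invariant)
  fix h x'
  assume "hd h 0 \<in> {Active 0, Active 1} \<and> hd h (Suc 0) = Active 0"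
    and "x' \<in> set_pmf (joint_step (duo s) {..<2} (hd h) (tend_producer h))"
  then show "x' 0 \<in> {Active 0, Active 1} \<and> x' (Suc 0) = Active 0"
    using set_joint_step_duo[of x' s "hd h" "tend_producer h"]
    by (auto simp: stationary_def send_at_def next_status_simps)
qed (simp add: initial_joint_duo)

lemma feasible_tend_producer:
  "feasible (duo s) {..<2} 1 (initial_joint (duo s) {..<2}) tend_producer"
  unfolding feasible_def
proof (intro allI ballI)
  fix t h
  assume "h \<in> set_pmf (run (duo s) {..<2} tend_producer (initial_joint (duo s) {..<2}) t)"
  then have "hd h 0 \<in> {Active 0, Active 1} \<and> hd h (Suc 0) = Active 0"
    by (rule run_tend_producer)
  then show "admissible {..<2} 1 (hd h) (tend_producer h)"
    by (auto simp: admissible_def stationary_def send_at_def is_active_def in_repair_def lessThan_2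
        intro: gr0I)
qed

text \<open>The potential of the upper bound also gives the lower one, its inequality being an
  equality in both reachable states of the producer.\<close>

lemma policy_value_tend_producer: "policy_value (duo s) {..<2} tend_producer = ereal (1 / 2)"
proof (rule antisym)
  show "policy_value (duo s) {..<2} tend_producer \<le> ereal (1 / 2)"
    by (intro policy_value_duo_le feasible_tend_producer)
  show "ereal (1 / 2) \<le> policy_value (duo s) {..<2} tend_producer"
    unfolding policy_value_def
  proof (rule avg_value_ge)
    let ?\<phi> = "\<lambda>z. if z = Active 0 then 1 else 1 / 2 :: real"
    show "bounded (range (\<lambda>x. ?\<phi> (x 0)))"
      by (rule bounded_range_if)
    fix t h
    let ?a = "tend_producer h"
    assume "h \<in> set_pmf (run (duo s) {..<2} tend_producer (initial_joint (duo s) {..<2}) t)"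
    then have h: "hd h 0 \<in> {Active 0, Active 1}"
      using run_tend_producer by blast
    have *: "measure_pmf.expectation (joint_step (duo s) {..<2} (hd h) ?a) (\<lambda>x. ?\<phi> (x 0)) =
        measure_pmf.expectation (next_status producer (0 \<in> sent ?a) (0 \<in> worked ?a) (hd h 0)) ?\<phi>"
      by (subst expectation_joint_step) auto
    show "1 / 2 + ?\<phi> (hd h 0) \<le> step_reward (duo s) {..<2} 0 (hd h) ?a
        + measure_pmf.expectation (joint_step (duo s) {..<2} (hd h) ?a) (\<lambda>x. ?\<phi> (x 0))"
      unfolding * step_reward_duo using h
      by (auto simp: stationary_def send_at_def next_status_simps)
  qed (auto simp: finite_transition_duo)
qed

section \<open>Runs and value of the Whittle index policy\<close>

definition whittle_state :: "nat joint \<Rightarrow> bool" where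
  "whittle_state x \<longleftrightarrow>
     x 0 = Active 0 \<and> x (Suc 0) = Active 0 \<or> x 0 = Active 1 \<and> x (Suc 0) \<in> {Active 0, InRepair}"

definition whittle_choice :: "nat joint \<Rightarrow> action" where
  "whittle_choice x =
     (if x 0 = Active 0 then \<lparr>sent = {1}, worked = {1}\<rparr>
      else if x (Suc 0) = Active 0 then \<lparr>sent = {0}, worked = {0}\<rparr>
      else \<lparr>sent = {}, worked = {1}\<rparr>)"

text \<open>With distinct indices and capacity 1 no ties arise. A fresh producer is not a candidate;
  a broken one beats an active decoy, but has to wait while the decoy's repair occupies the
  capacity.\<close>

lemma whittle_action_duo_iff:
  assumes x: "whittle_state x" and W: "W 0 0 = - 1" "W 0 1 = 1" "W (Suc 0) 0 = 0"
  shows "whittle_action {..<2} 1 W x a \<longleftrightarrow> a = whittle_choice x"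
proof -
  obtain A B where a: "a = \<lparr>sent = A, worked = B\<rparr>"
    by (cases a) auto
  have I: "in_repair {..<2} x = (if x (Suc 0) = InRepair then {1} else {})"
    and C: "candidates {..<2} W x =
      (if x 0 = Active 1 then {0} else {}) \<union> (if x (Suc 0) = Active 0 then {1} else {})"
    using x W by (auto simp: whittle_state_def in_repair_def candidates_def lessThan_2 intro: gr0I)
  show ?thesis
  proof
    assume *: "whittle_action {..<2} 1 W x a"
    then have AB: "A \<subseteq> candidates {..<2} W x" "B = in_repair {..<2} x \<union> A" "card B \<le> 1"
      and cand: "\<And>j. j \<in> candidates {..<2} W x \<Longrightarrow> j \<notin> A \<Longrightarrow>
        card B = 1 \<and> (\<forall>i\<in>A. current_index W x j \<le> current_index W x i)"
      by (auto simp: whittle_action_def admissible_def a)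
    have "A \<subseteq> {0, Suc 0}"
      using AB(1) by (auto simp: C split: if_splits)
    then have "A = {} \<or> A = {0} \<or> A = {Suc 0} \<or> A = {0, Suc 0}"
      by auto
    then show "a = whittle_choice x"
      using x W AB cand[of 0] cand[of "Suc 0"]
      by (elim disjE) (auto simp: a I C whittle_state_def whittle_choice_def current_index_def)
  next
    assume "a = whittle_choice x"
    then show "whittle_action {..<2} 1 W x a"
      using x W unfolding whittle_action_def admissible_def I C
      by (auto simp: whittle_state_def whittle_choice_def current_index_def is_active_def)
  qed
qed

text \<open>The producer is repaired only while the decoy is active and waits, so it is never fresh
  during a decoy repair. The premise assumes \<open>whittle_state\<close> because only there do the
  indices fix the action.\<close>

lemma run_whittle:
  assumes "\<And>t h. h \<in> set_pmf (run (duo s) {..<2} \<pi> (initial_joint (duo s) {..<2}) t) \<Longrightarrow>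
      whittle_state (hd h) \<Longrightarrow> \<pi> h = whittle_choice (hd h)"
    and "h \<in> set_pmf (run (duo s) {..<2} \<pi> (initial_joint (duo s) {..<2}) t)"
  shows "whittle_state (hd h)"
  using _ _ assms(2)
proof (rule run_invariant)
  fix t h x'
  assume "h \<in> set_pmf (run (duo s) {..<2} \<pi> (initial_joint (duo s) {..<2}) t)"
    and x: "whittle_state (hd h)"
    and x': "x' \<in> set_pmf (joint_step (duo s) {..<2} (hd h) (\<pi> h))"
  then have "\<pi> h = whittle_choice (hd h)"
    using assms(1) by blast
  with x set_joint_step_duo[OF x'] show "whittle_state x'"
    by (auto simp: whittle_state_def whittle_choice_def next_status_simps split: if_splits)
qed (simp add: initial_joint_duo whittle_state_def)

lemma whittle_policy_duo_iff:
  assumes s: "0 < s" "s \<le> 1"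
  shows "whittle_policy (duo s) {..<2} 1 \<pi> \<longleftrightarrow>
    (\<forall>t. \<forall>h\<in>set_pmf (run (duo s) {..<2} \<pi> (initial_joint (duo s) {..<2}) t).
       whittle_state (hd h) \<and> \<pi> h = whittle_choice (hd h))"
    (is "_ \<longleftrightarrow> ?R")
proof
  note indices = whittle_index_producer_fresh whittle_index_producer_broken whittle_index_decoy[OF s]
  show ?R if "whittle_policy (duo s) {..<2} 1 \<pi>"
  proof -
    from that obtain W
      where W: "\<forall>i\<in>{..<2}. \<forall>u\<in>active_states (duo s i). is_whittle_index (duo s) i u (W i u)"
        and act: "\<forall>t. \<forall>h\<in>set_pmf (run (duo s) {..<2} \<pi> (initial_joint (duo s) {..<2}) t).
          whittle_action {..<2} 1 W (hd h) (\<pi> h)"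
      unfolding whittle_policy_def by blast
    \<comment> \<open>Whittle indices are unique, so the existentially quantified \<open>W\<close>
      is known on all active states.\<close>
    have "W 0 0 = - 1" "W 0 1 = 1" "W (Suc 0) 0 = 0"
      using W[rule_format, of 0 0] W[rule_format, of 0 1] W[rule_format, of 1 0] indices
      by (auto simp: intro: is_whittle_index_unique)
    then show ?thesis
      using act run_whittle[of s \<pi>] whittle_action_duo_iff by blast
  qed
  show "whittle_policy (duo s) {..<2} 1 \<pi>" if ?R
  proof -
    define W :: "nat \<Rightarrow> nat \<Rightarrow> real" where
      "W i u = (if i = 0 then if u = 0 then - 1 else 1 else 0)" for i u
    have "\<forall>i\<in>{..<2}. \<forall>u\<in>active_states (duo s i). is_whittle_index (duo s) i u (W i u)"
      using indices
      by (auto simp: lessThan_2 W_def)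
    moreover have "whittle_action {..<2} 1 W (hd h) (\<pi> h)"
      if "h \<in> set_pmf (run (duo s) {..<2} \<pi> (initial_joint (duo s) {..<2}) t)" for t h
      using that \<open>?R\<close> whittle_action_duo_iff[of "hd h" W] by (auto simp: W_def)
    ultimately show ?thesis
      unfolding whittle_policy_def by blast
  qed
qed

lemma whittle_policy_whittle_choice:
  assumes "0 < s" "s \<le> 1"
  shows "whittle_policy (duo s) {..<2} 1 (stationary whittle_choice)"
  using run_whittle[of s "stationary whittle_choice"]
  by (auto simp: whittle_policy_duo_iff[OF assms] stationary_def simp del: One_nat_def)

text \<open>A cycle earns 1 and lasts \<open>1 / s + 1\<close> steps on average; the simpler bound
  \<open>s\<close> is enough. An active decoy has potential 1, which pays for the reward in the step
  that sends it and is recovered at rate \<open>s\<close> during its repair. A fresh producer has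
  potential \<open>s\<close>, gained in its own repair step.\<close>

lemma policy_value_whittle_duo_le:
  assumes s: "0 < s" "s \<le> 1" and whittle: "whittle_policy (duo s) {..<2} 1 \<pi>"
  shows "policy_value (duo s) {..<2} \<pi> \<le> ereal s"
  unfolding policy_value_def
proof (rule avg_value_le)
  let ?\<alpha> = "\<lambda>z. if z = Active 0 then s else 0" and ?\<beta> = "\<lambda>z. if z = Active 0 then 1 else 0 :: real"
  show "bounded (range (\<lambda>x. ?\<alpha> (x 0) + ?\<beta> (x (Suc 0))))"
    by (intro bounded_plus_comp bounded_range_if)
  fix t h
  assume "h \<in> set_pmf (run (duo s) {..<2} \<pi> (initial_joint (duo s) {..<2}) t)"
  then have h: "whittle_state (hd h)" "\<pi> h = whittle_choice (hd h)"
    using whittle unfolding whittle_policy_duo_iff[OF s] by auto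
  let ?J = "joint_step (duo s) {..<2} (hd h) (\<pi> h)"
  have "finite (set_pmf ?J)"
    by (intro finite_set_joint_step finite_transition_duo) auto
  \<comment> \<open>Linearity alone reduces this to the two marginals.\<close>
  then have "measure_pmf.expectation ?J (\<lambda>x. ?\<alpha> (x 0) + ?\<beta> (x (Suc 0))) =
      measure_pmf.expectation ?J (\<lambda>x. ?\<alpha> (x 0)) + measure_pmf.expectation ?J (\<lambda>x. ?\<beta> (x (Suc 0)))"
    by (intro Bochner_Integration.integral_add integrable_measure_pmf_finite)
  also have "\<dots> =
      measure_pmf.expectation (next_status producer (0 \<in> sent (\<pi> h)) (0 \<in> worked (\<pi> h)) (hd h 0)) ?\<alpha> +
      measure_pmf.expectation
        (next_status (decoy s) (Suc 0 \<in> sent (\<pi> h)) (Suc 0 \<in> worked (\<pi> h)) (hd h (Suc 0))) ?\<beta>"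
    by (subst (1 2) expectation_joint_step) auto
  finally have *: "measure_pmf.expectation ?J (\<lambda>x. ?\<alpha> (x 0) + ?\<beta> (x (Suc 0))) = \<dots>" .
  show "step_reward (duo s) {..<2} 0 (hd h) (\<pi> h)
      + measure_pmf.expectation ?J (\<lambda>x. ?\<alpha> (x 0) + ?\<beta> (x (Suc 0)))
      \<le> s + (?\<alpha> (hd h 0) + ?\<beta> (hd h (Suc 0)))"
    unfolding * step_reward_duo unfolding h(2) using h(1) s
    by (auto simp: whittle_state_def whittle_choice_def next_status_simps)
qed (auto simp: finite_transition_duo)

theorem theorem12:
  fixes \<epsilon> :: real
  assumes "\<epsilon> > 0"
  shows "\<exists>(ms :: nat \<Rightarrow> nat machine) opt.
           (\<forall>i\<in>{..<2}. valid_machine (ms i)) \<and>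
           optimal_policy ms {..<2} 1 opt \<and>
           0 < policy_value ms {..<2} opt \<and>
           (\<exists>\<pi>. whittle_policy ms {..<2} 1 \<pi>) \<and>
           (\<forall>\<pi>. whittle_policy ms {..<2} 1 \<pi> \<longrightarrow>
              policy_value ms {..<2} \<pi> \<le> ereal \<epsilon> * policy_value ms {..<2} opt)"
proof -
  \<comment> \<open>The optimal value is 1/2, so the bound \<open>s\<close> has to be at most
    \<open>\<epsilon> / 2\<close>; the minimum with 1 keeps \<open>s\<close> a legal repair
    rate.\<close>
  define s where "s = min 1 (\<epsilon> / 2)"
  have s: "0 < s" "s \<le> 1" "s \<le> \<epsilon> / 2"
    using assms by (auto simp: s_def)
  show ?thesis
  proof (intro exI conjI allI impI)
    show "\<forall>i\<in>{..<2}. valid_machine (duo s i)"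
      using s by (simp add: lessThan_2 valid_producer valid_decoy)
    show "optimal_policy (duo s) {..<2} 1 tend_producer"
      by (simp add: optimal_policy_def feasible_tend_producer policy_value_tend_producer
          policy_value_duo_le del: One_nat_def)
    show "0 < policy_value (duo s) {..<2} tend_producer"
      by (simp add: policy_value_tend_producer del: One_nat_def)
    show "whittle_policy (duo s) {..<2} 1 (stationary whittle_choice)"
      using s by (intro whittle_policy_whittle_choice)
  next
    fix \<pi>
    assume "whittle_policy (duo s) {..<2} 1 \<pi>"
    then have "policy_value (duo s) {..<2} \<pi> \<le> ereal s"
      using s by (intro policy_value_whittle_duo_le)
    also have "\<dots> \<le> ereal \<epsilon> * policy_value (duo s) {..<2} tend_producer"
      using s by (simp add: policy_value_tend_producer del: One_nat_def)
    finally show "policy_value (duo s) {..<2} \<pi> \<le> ereal \<epsilon> * policy_value (duo s) {..<2} tend_producer" .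
  qed
qed

end
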